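(* Let $\epsilon_0>0$ and suppose $\gamma$ is a decreasing function defined on the positive integers. If either $\gamma$ is exponentially decreasing with $\gamma(k)=Ce^{-\beta k}$ for some $\beta>\log(\epsilon_0^{-2}+1)$ and $C>0$, or $\gamma$ is exact banding for some $k_0>0$ (that is, $\gamma(k)=0$ for all $k>k_0$), then $$\mathcal U(\epsilon_0,C_1\gamma)\ \subseteq\ \mathcal U^*(\epsilon_0,\gamma)\ \subseteq\ \mathcal U(\epsilon_0,C_2\gamma)$$ for some positive constants $C_1$ and $C_2$ not depending on $p$.
   Context: Every $p\times p$ positive definite matrix $\Omega$ has a unique modified Cholesky decomposition (MCD) $\Omega=(I_p-A)^TD^{-1}(I_p-A)$, with $A=(a_{ij})$ lower triangular with zero diagonal and $D$ diagonal with positive diagonal entries. For a matrix $A=(a_{ij})$, $B_k(A)=(a_{ij}I(|i-j|\le k))_{i,j}$ and $\|A\|_\infty=\max_i\sum_j|a_{ij}|$. $\mathcal U(\epsilon_0,\gamma)=\mathcal U_p(\epsilon_0,\gamma)$ is the set of $p\times p$ positive definite $\Omega$ with MCD $\Omega=(I_p-A)^TD^{-1}(I_p-A)$ such that $\epsilon_0\le\lambda_{\min}(\Omega)\le\lambda_{\max}(\Omega)\le\epsilon_0^{-1}$ and $\|A-B_k(A)\|_\infty\le\gamma(k)$ for all $0<k\le p-1$. $\mathcal U^*(\epsilon_0,\gamma)=\mathcal U^*_p(\epsilon_0,\gamma)$ is the set of $p\times p$ positive definite $\Omega=(\omega_{ij})$ such that $0<\epsilon_0\le\lambda_{\min}(\Omega)\le\lambda_{\max}(\Omega)\le\epsilon_0^{-1}$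 and $\max_{1\le i\le p}\sum_{j:|i-j|>k}|\omega_{ij}|\le\gamma(k)$ for all $0<k\le p-1$. *)

theory Defs
  imports Jordan_Normal_Form.Spectral_Radius
begin

text \<open>
  The dimension \<open>p\<close> is quantified inside the main statement, so matrices are Jordan_Normal_Form
  matrices in \<open>carrier_mat p p\<close>. Indices therefore run over \<open>0, \<dots>, p - 1\<close>.
\<close>

definition pos_def_mat :: "nat \<Rightarrow> real mat \<Rightarrow> bool" where
  "pos_def_mat p M \<longleftrightarrow> M \<in> carrier_mat p p \<and> M\<^sup>T = M \<and>
     (\<forall>v \<in> carrier_vec p. v \<noteq> 0\<^sub>v p \<longrightarrow> v \<bullet> (M *\<^sub>v v) > 0)"

text \<open>
  These are meaningful when all eigenvalues are real and \<open>p \<ge> 1\<close>, as for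
  the symmetric matrices considered below: then the real spectrum is finite and nonempty.
\<close>

definition lambda_min :: "real mat \<Rightarrow> real" where
  "lambda_min M = Min (spectrum M)"

definition lambda_max :: "real mat \<Rightarrow> real" where
  "lambda_max M = Max (spectrum M)"

definition band_mat :: "nat \<Rightarrow> real mat \<Rightarrow> real mat" where
  "band_mat k M = mat (dim_row M) (dim_col M)
     (\<lambda>(i, j). if \<bar>int i - int j\<bar> \<le> int k then M $$ (i, j) else 0)"

definition norm_inf_mat :: "real mat \<Rightarrow> real" where
  "norm_inf_mat M = Max ((\<lambda>i. \<Sum>j<dim_col M. \<bar>M $$ (i, j)\<bar>) ` {..<dim_row M})"

text \<open>
  Modified Cholesky decomposition \<open>M = (I - A)\<^sup>T D\<^sup>-\<^sup>1 (I - A)\<close>;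
  the matrix \<open>E\<close> below is the (unique) inverse of \<open>D\<close>.
\<close>

definition is_mcd :: "nat \<Rightarrow> real mat \<Rightarrow> real mat \<Rightarrow> real mat \<Rightarrow> bool" where
  "is_mcd p M A D \<longleftrightarrow>
     A \<in> carrier_mat p p \<and> (\<forall>i<p. \<forall>j<p. i \<le> j \<longrightarrow> A $$ (i, j) = 0) \<and>
     D \<in> carrier_mat p p \<and> diagonal_mat D \<and> (\<forall>i<p. D $$ (i, i) > 0) \<and>
     (\<exists>E \<in> carrier_mat p p. inverts_mat D E \<and> inverts_mat E D \<and>
        M = (1\<^sub>m p - A)\<^sup>T * E * (1\<^sub>m p - A))"

definition U_class :: "nat \<Rightarrow> real \<Rightarrow> (nat \<Rightarrow> real) \<Rightarrow> real mat set" where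
  "U_class p \<epsilon> \<gamma> = {M. pos_def_mat p M \<and>
     \<epsilon> \<le> lambda_min M \<and> lambda_min M \<le> lambda_max M \<and> lambda_max M \<le> inverse \<epsilon> \<and>
     (\<exists>A D. is_mcd p M A D \<and>
        (\<forall>k. 0 < k \<and> k \<le> p - 1 \<longrightarrow> norm_inf_mat (A - band_mat k A) \<le> \<gamma> k))}"

definition Ustar_class :: "nat \<Rightarrow> real \<Rightarrow> (nat \<Rightarrow> real) \<Rightarrow> real mat set" where
  "Ustar_class p \<epsilon> \<gamma> = {M. pos_def_mat p M \<and>
     0 < \<epsilon> \<and> \<epsilon> \<le> lambda_min M \<and> lambda_min M \<le> lambda_max M \<and> lambda_max M \<le> inverse \<epsilon> \<and>
     (\<forall>k. 0 < k \<and> k \<le> p - 1 \<longrightarrow>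
        Max ((\<lambda>i. \<Sum>j | j < p \<and> \<bar>int i - int j\<bar> > int k. \<bar>M $$ (i, j)\<bar>) ` {..<p}) \<le> \<gamma> k)}"

end

theory Submission
  imports Defs "HOL-Analysis.Convex"
begin

text \<open>
  Write \<open>l = I - A\<close>, so that \<open>\<Omega> = l\<^sup>T D\<^sup>-\<^sup>1 l\<close> reads \<open>\<omega>\<^sub>i\<^sub>j = (\<Sum>m \<ge> max i j. l\<^sub>m\<^sub>i l\<^sub>m\<^sub>j / d\<^sub>m)\<close>. If the
  spectrum of \<open>\<Omega>\<close> lies in \<open>[\<epsilon>, 1 / \<epsilon>]\<close>, then evaluating the quadratic form of \<open>\<Omega>\<close> at unit vectors
  and at the columns of the inverse of \<open>l\<close> bounds \<open>1 / d\<^sub>m\<close>, \<open>d\<^sub>m\<close>, \<open>\<bar>l\<^sub>m\<^sub>i\<bar>\<close> and \<open>\<bar>l\<^sub>m\<^sub>i\<bar> / d\<^sub>m\<close> by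
  \<open>1 / \<epsilon>\<close>, whatever the dimension.

  From the factor to the matrix: by the displayed formula, a tail of row \<open>i\<close> of \<open>\<Omega>\<close> beyond distance
  \<open>k\<close> is bounded by a constant times \<open>\<gamma> k + \<gamma> (k + 1) + \<dots>\<close> if the tails of the rows of \<open>A\<close> are
  bounded by \<open>\<gamma>\<close> (\<open>w_left_tail_le\<close>, \<open>w_right_tail_le\<close>). In both cases of the theorem this series is at
  most a multiple of \<open>\<gamma> k\<close>, and the bound is linear in the constant in front of \<open>\<gamma>\<close>.

  From the matrix to the factor: solving the formula for \<open>l\<^sub>i\<^sub>j\<close> bounds the tail of row \<open>i\<close> of the
  factor by that of \<open>\<Omega>\<close> and by the tails of the later rows of the factor, taken at the
  correspondingly larger distances \<open>k + (m - i)\<close> (\<open>tail_recursion\<close>). With geometric decay \<open>\<gamma> k = C r\<^sup>k\<close>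
  the contribution of the later rows carries the factor \<open>\<epsilon>\<^sup>-\<^sup>2 (r + r\<^sup>2 + \<dots>)\<close>. It is less than \<open>1\<close>
  precisely for \<open>r (\<epsilon>\<^sup>-\<^sup>2 + 1) < 1\<close>, the assumption on \<open>\<beta>\<close>, and backward induction on the rows closes
  (\<open>l_tail_geometric\<close>). With exact banding the same recursion shows that the factor is banded
  (\<open>l_tail_banded\<close>), and the finitely many entries of a row in the band are bounded.

  Eigenvalue bounds become bounds on the quadratic form by a variational argument
  (\<open>eigenvalue_below_quad_form\<close>), and the decomposition is constructed by iterated Schur complements
  (\<open>cholesky_exists\<close>).
\<close>

section \<open>Schur complements of positive definite forms\<close>

text \<open>
  Forms and factors are functions on index pairs, read only below the dimension \<open>p\<close>; an
  induction on the dimension then needs no submatrices.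
\<close>
definition quad_form :: "nat \<Rightarrow> (nat \<Rightarrow> nat \<Rightarrow> real) \<Rightarrow> (nat \<Rightarrow> real) \<Rightarrow> real" where
  "quad_form p f v = (\<Sum>i<p. \<Sum>j<p. f i j * v i * v j)"

definition sq_sum :: "nat \<Rightarrow> (nat \<Rightarrow> real) \<Rightarrow> real" where
  "sq_sum p v = (\<Sum>i<p. (v i)\<^sup>2)"

definition sym_entries :: "nat \<Rightarrow> (nat \<Rightarrow> nat \<Rightarrow> real) \<Rightarrow> bool" where
  "sym_entries p f \<longleftrightarrow> (\<forall>i<p. \<forall>j<p. f i j = f j i)"

definition pos_def_on :: "nat \<Rightarrow> (nat \<Rightarrow> nat \<Rightarrow> real) \<Rightarrow> bool" where
  "pos_def_on p f \<longleftrightarrow> (\<forall>v. (\<exists>i<p. v i \<noteq> 0) \<longrightarrow> quad_form p f v > 0)"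

text \<open>
  The last index \<open>p\<close> of a form in dimension \<open>Suc p\<close> is eliminated.
\<close>
definition schur_compl :: "nat \<Rightarrow> (nat \<Rightarrow> nat \<Rightarrow> real) \<Rightarrow> nat \<Rightarrow> nat \<Rightarrow> real" where
  "schur_compl p f i j = f i j - f p i * f p j / f p p"

lemma quad_form_cong:
  assumes "\<And>i. i < p \<Longrightarrow> v i = w i"
  shows "quad_form p f v = quad_form p f w"
  unfolding quad_form_def using assms by simp

lemma quad_form_unit:
  assumes "i < p"
  shows "quad_form p f (\<lambda>j. if j = i then 1 else 0) = f i i"
  unfolding quad_form_def using assms
  by (simp add: if_distrib[of "\<lambda>x. _ * x"] sum.If_cases flip: sum.inter_filter cong: if_cong)

text \<open>
  Completing the square in the last variable. Both inductions on the dimension below, for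
  coercivity and for the existence of a factorization, rest on this identity.
\<close>
lemma quad_form_Suc:
  assumes "sym_entries (Suc p) f" and "f p p \<noteq> 0"
  shows "quad_form (Suc p) f v =
    quad_form p (schur_compl p f) v + f p p * (v p + (\<Sum>i<p. f p i * v i) / f p p)\<^sup>2"
proof -
  define s where "s = (\<Sum>i<p. f p i * v i)"
  have "quad_form (Suc p) f v =
      quad_form p f v + (\<Sum>i<p. f i p * v i * v p) + (\<Sum>j<p. f p j * v p * v j) + f p p * v p * v p"
    unfolding quad_form_def by (simp add: sum.distrib)
  also have "(\<Sum>i<p. f i p * v i * v p) = s * v p"
    unfolding s_def sum_distrib_right using assms(1) by (intro sum.cong) (auto simp: sym_entries_def)
  also have "(\<Sum>j<p. f p j * v p * v j) = s * v p"
    unfolding s_def sum_distrib_right by (simp add: mult_ac)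
  finally have 1: "quad_form (Suc p) f v = quad_form p f v + 2 * (s * v p) + f p p * (v p)\<^sup>2"
    by (simp add: power2_eq_square)
  have "s * s = (\<Sum>i<p. \<Sum>j<p. (f p i * v i) * (f p j * v j))"
    unfolding s_def by (rule sum_product)
  hence "quad_form p (schur_compl p f) v = quad_form p f v - s * s / f p p"
    unfolding quad_form_def schur_compl_def
    by (simp add: sum_divide_distrib right_diff_distrib sum_subtractf mult_ac)
  moreover have "f p p * (v p + s / f p p)\<^sup>2 = f p p * (v p)\<^sup>2 + 2 * (s * v p) + s * s / f p p"
    using assms(2) by (simp add: field_simps power2_eq_square)
  ultimately show ?thesis
    using 1 unfolding s_def[symmetric] by linarith
qed

lemma pos_def_onD: "pos_def_on p f \<Longrightarrow> i < p \<Longrightarrow> v i \<noteq> 0 \<Longrightarrow> 0 < quad_form p f v"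
  unfolding pos_def_on_def by blast

lemma pos_def_on_diag:
  assumes "pos_def_on p f" "i < p"
  shows "0 < f i i"
  using pos_def_onD[OF assms, of "\<lambda>k. if k = i then 1 else 0"] quad_form_unit[OF assms(2), of f]
  by simp

lemma sym_entries_schur_compl: "sym_entries (Suc p) f \<Longrightarrow> sym_entries p (schur_compl p f)"
  unfolding sym_entries_def schur_compl_def by simp

text \<open>
  Extending a vector by the last coordinate that makes the completed square vanish turns the
  value of the Schur complement into a value of the whole form.
\<close>
lemma pos_def_on_schur_compl:
  assumes "sym_entries (Suc p) f" "pos_def_on (Suc p) f"
  shows "pos_def_on p (schur_compl p f)"
  unfolding pos_def_on_def
proof (intro allI impI)
  fix v :: "nat \<Rightarrow> real" assume v: "\<exists>i<p. v i \<noteq> 0"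
  have pp: "f p p > 0" using pos_def_on_diag[OF assms(2)] by simp
  define w where "w = v(p := - (\<Sum>i<p. f p i * v i) / f p p)"
  have "\<exists>i<Suc p. w i \<noteq> 0" using v unfolding w_def by (auto intro: less_SucI)
  hence "0 < quad_form (Suc p) f w" using assms(2) unfolding pos_def_on_def by blast
  also have "\<dots> = quad_form p (schur_compl p f) w"
    using pp by (subst quad_form_Suc[OF assms(1)]) (auto simp: w_def)
  also have "\<dots> = quad_form p (schur_compl p f) v"
    by (rule quad_form_cong) (simp add: w_def)
  finally show "quad_form p (schur_compl p f) v > 0" .
qed

text \<open>
  Induction along Schur complements takes the place of the compactness of the unit sphere: the
  last coordinate is recovered from the completed square and from the other coordinates, on which
  the Schur complement is coercive.
\<close>
lemma pos_def_on_coercive: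
  assumes "sym_entries p f" "pos_def_on p f"
  shows "\<exists>c>0. \<forall>v. c * sq_sum p v \<le> quad_form p f v"
  using assms
proof (induction p arbitrary: f)
  case 0
  show ?case by (intro exI[of _ 1]) (simp add: sq_sum_def quad_form_def)
next
  case (Suc p)
  obtain c where c: "c > 0" and cv: "\<And>v. c * sq_sum p v \<le> quad_form p (schur_compl p f) v"
    using Suc.IH[OF sym_entries_schur_compl[OF Suc.prems(1)] pos_def_on_schur_compl[OF Suc.prems]] by blast
  have pp: "f p p > 0" using pos_def_on_diag[OF Suc.prems(2)] by simp
  define b where "b = (\<Sum>i<p. (f p i / f p p)\<^sup>2)"
  have b0: "b \<ge> 0" unfolding b_def by (simp add: sum_nonneg)
  \<comment> \<open>The first bound pays for \<open>2 * (v p + s)\<^sup>2\<close>, the second for \<open>sq_sum p v\<close> and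
    \<open>2 * s\<^sup>2 \<le> 2 * b * sq_sum p v\<close>.\<close>
  define e where "e = min (f p p / 2) (c / (1 + 2 * b))"
  have e0: "e > 0" using pp c b0 by (simp add: e_def)
  have e1: "2 * e \<le> f p p" by (simp add: e_def)
  have "e \<le> c / (1 + 2 * b)" by (simp add: e_def)
  hence e2: "e * (1 + 2 * b) \<le> c" using b0 by (simp add: field_simps)
  show ?case
  proof (intro exI[of _ e] conjI allI e0)
    fix v
    define s where "s = (\<Sum>i<p. f p i * v i) / f p p"
    have s: "s = (\<Sum>i<p. (f p i / f p p) * v i)" unfolding s_def by (simp add: sum_divide_distrib)
    have "s\<^sup>2 \<le> b * sq_sum p v"
      unfolding s b_def sq_sum_def by (rule Cauchy_Schwarz_ineq_sum)
    moreover have "(v p)\<^sup>2 \<le> 2 * (v p + s)\<^sup>2 + 2 * s\<^sup>2"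
      using sum_squares_ge_zero[of "v p + 2 * s" 0] by (simp add: power2_eq_square algebra_simps)
    ultimately have "(v p)\<^sup>2 \<le> 2 * (v p + s)\<^sup>2 + 2 * (b * sq_sum p v)" by linarith
    hence "e * (v p)\<^sup>2 \<le> e * (2 * (v p + s)\<^sup>2 + 2 * (b * sq_sum p v))"
      using e0 by (intro mult_left_mono) auto
    hence "e * sq_sum (Suc p) v \<le> (e * (1 + 2 * b)) * sq_sum p v + (2 * e) * (v p + s)\<^sup>2"
      by (simp add: sq_sum_def algebra_simps)
    also have "\<dots> \<le> c * sq_sum p v + f p p * (v p + s)\<^sup>2"
      using e1 e2 by (intro add_mono mult_right_mono) (auto simp: sq_sum_def sum_nonneg)
    also have "\<dots> \<le> quad_form (Suc p) f v"
      using cv[of v] pp by (subst quad_form_Suc[OF Suc.prems(1)]) (auto simp: s_def)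
    finally show "e * sq_sum (Suc p) v \<le> quad_form (Suc p) f v" .
  qed
qed

definition unit_lower :: "(nat \<Rightarrow> nat \<Rightarrow> real) \<Rightarrow> bool" where
  "unit_lower l \<longleftrightarrow> (\<forall>i. l i i = 1) \<and> (\<forall>i j. i < j \<longrightarrow> l i j = 0)"

text \<open>
  The last row of the factor is the last row of \<open>f\<close> divided by its diagonal entry; what it does
  not account for is the Schur complement, which is factored by induction.
\<close>
lemma cholesky_exists:
  assumes "sym_entries p f" "pos_def_on p f"
  shows "\<exists>l d. unit_lower l \<and> (\<forall>m<p. d m > 0) \<and> (\<forall>i<p. \<forall>j<p. f i j = (\<Sum>m<p. l m i * l m j / d m))"
  using assms
proof (induction p arbitrary: f)
  case 0
  show ?case
    by (intro exI[of _ "\<lambda>i j. if i = j then 1 else 0"]) (simp add: unit_lower_def)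
next
  case (Suc p)
  obtain l d where l: "unit_lower l" and d: "\<forall>m<p. d m > 0"
    and f: "\<And>i j. i < p \<Longrightarrow> j < p \<Longrightarrow> schur_compl p f i j = (\<Sum>m<p. l m i * l m j / d m)"
    using Suc.IH[OF sym_entries_schur_compl[OF Suc.prems(1)] pos_def_on_schur_compl[OF Suc.prems]] by blast
  have pp: "f p p > 0" using pos_def_on_diag[OF Suc.prems(2)] by simp
  define l' where "l' = l(p := (\<lambda>j. if j \<le> p then f p j / f p p else 0))"
  define d' where "d' = d(p := 1 / f p p)"
  have l': "unit_lower l'" using l pp by (auto simp: l'_def unit_lower_def)
  have d': "\<forall>m<Suc p. d' m > 0" using d pp by (auto simp: d'_def less_Suc_eq)
  have f': "f i j = (\<Sum>m<Suc p. l' m i * l' m j / d' m)" if ij: "i < Suc p" "j < Suc p" for i j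
  proof -
    have *: "(\<Sum>m<Suc p. l' m i * l' m j / d' m) = (\<Sum>m<p. l m i * l m j / d m) + f p i * f p j / f p p"
      using ij pp by (simp add: l'_def d'_def)
    show ?thesis
    proof (cases "i < p \<and> j < p")
      case True
      thus ?thesis unfolding * using f[of i j] by (simp add: schur_compl_def)
    next
      case False
      hence ij': "i = p \<or> j = p" using ij by linarith
      hence "(\<Sum>m<p. l m i * l m j / d m) = 0"
        using l by (intro sum.neutral) (auto simp: unit_lower_def)
      moreover have "f i p = f p i"
        using ij Suc.prems(1) unfolding sym_entries_def by (metis lessI)
      hence "f i j = f p i * f p j / f p p" using ij' pp by auto
      ultimately show ?thesis unfolding * by simp
    qed
  qed
  from l' d' f' show ?case by blast
qed

section \<open>Quadratic forms and extreme eigenvalues\<close>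

lemma scalar_prod_mult_mat_vec:
  assumes "M \<in> carrier_mat p p" "v \<in> carrier_vec p" "w \<in> carrier_vec p"
  shows "w \<bullet> (M *\<^sub>v v) = (\<Sum>i<p. w $ i * (\<Sum>j<p. M $$ (i, j) * v $ j))"
  using assms by (auto simp: scalar_prod_def atLeast0LessThan intro!: sum.cong)

lemma quad_form_mat:
  assumes "M \<in> carrier_mat p p"
  shows "quad_form p (\<lambda>i j. M $$ (i, j)) v = vec p v \<bullet> (M *\<^sub>v vec p v)"
  using assms by (simp add: scalar_prod_mult_mat_vec quad_form_def sum_distrib_left mult_ac)

text \<open>
  Otherwise the form would be negative at a point slightly moved from \<open>v\<close> in the \<open>i\<close>-th
  coordinate direction, since the linear term dominates there.
\<close>
lemma psd_null_vector:
  assumes sym: "sym_entries p f" and psd: "\<And>w. 0 \<le> quad_form p f w" and v: "quad_form p f v = 0"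
    and i: "i < p"
  shows "(\<Sum>j<p. f i j * v j) = 0"
proof (rule ccontr)
  define a where "a = (\<Sum>j<p. f i j * v j)"
  assume "\<not> ?thesis"
  hence a: "a \<noteq> 0" by (simp add: a_def)
  define e where "e = (\<lambda>j. if j = i then 1 else (0::real))"
  have Q: "quad_form p f (\<lambda>j. v j + s * e j) = 2 * s * a + s\<^sup>2 * f i i" for s
  proof -
    have 1: "(\<Sum>i'<p. \<Sum>j<p. f i' j * e i' * v j) = a"
    proof -
      have "(\<Sum>i'<p. \<Sum>j<p. f i' j * e i' * v j) = (\<Sum>i'<p. if i' = i then \<Sum>j<p. f i' j * v j else 0)"
        by (intro sum.cong) (auto simp: e_def)
      thus ?thesis using i by (simp add: a_def)
    qed
    have 2: "(\<Sum>i'<p. \<Sum>j<p. f i' j * v i' * e j) = a"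
    proof -
      have "(\<Sum>i'<p. \<Sum>j<p. f i' j * v i' * e j) = (\<Sum>i'<p. \<Sum>j<p. f j i' * e j * v i')"
        using sym by (intro sum.cong) (auto simp: sym_entries_def)
      also have "\<dots> = (\<Sum>j<p. \<Sum>i'<p. f j i' * e j * v i')" by (rule sum.swap)
      finally show ?thesis using 1 by simp
    qed
    have 3: "quad_form p f e = f i i" unfolding e_def by (rule quad_form_unit[OF i])
    have "quad_form p f (\<lambda>j. v j + s * e j) = quad_form p f v + s * (\<Sum>i'<p. \<Sum>j<p. f i' j * e i' * v j)
       + s * (\<Sum>i'<p. \<Sum>j<p. f i' j * v i' * e j) + s\<^sup>2 * quad_form p f e"
      unfolding quad_form_def by (simp add: sum_distrib_left sum.distrib algebra_simps power2_eq_square)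
    thus ?thesis using 1 2 3 v by simp
  qed
  have fi: "0 \<le> f i i" using psd[of e] quad_form_unit[OF i, of f] by (simp add: e_def)
  \<comment> \<open>The step \<open>- r * a\<close> is so short that the quadratic term cannot outweigh the linear one.\<close>
  define r where "r = 1 / (1 + f i i)"
  have r: "r > 0" "r * f i i < 1" using fi by (auto simp: r_def)
  have "0 \<le> 2 * (- r * a) * a + (- r * a)\<^sup>2 * f i i"
    using psd[of "\<lambda>j. v j + (- r * a) * e j"] Q[of "- r * a"] by simp
  also have "\<dots> = - ((a\<^sup>2 * r) * (2 - r * f i i))"
    by (simp add: algebra_simps power2_eq_square)
  finally have "(a\<^sup>2 * r) * (2 - r * f i i) \<le> 0" by simp
  moreover have "(a\<^sup>2 * r) * (2 - r * f i i) > 0"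
    using a r by (intro mult_pos_pos) auto
  ultimately show False by simp
qed

text \<open>
  The supremum \<open>\<mu>\<close> of all \<open>t\<close> with \<open>t * sq_sum p v \<le> quad_form p M v\<close> is attained, so \<open>M - \<mu> I\<close>
  is positive semidefinite. It is not positive definite, because coercivity would allow a larger \<open>t\<close>.
  A vector on which its form vanishes is then in its kernel, that is, an eigenvector for \<open>\<mu>\<close>.
\<close>
lemma eigenvalue_below_quad_form:
  assumes M: "M \<in> carrier_mat p p" and sym: "M\<^sup>T = M" and p: "p \<ge> 1"
  shows "\<exists>\<mu>\<in>spectrum M. \<forall>v. \<mu> * sq_sum p v \<le> quad_form p (\<lambda>i j. M $$ (i, j)) v"
proof -
  define f where "f = (\<lambda>i j. M $$ (i, j))"
  have f: "sym_entries p f"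
    unfolding sym_entries_def f_def using M sym by (metis carrier_matD index_transpose_mat(1))
  define T where "T = {t. \<forall>v. t * sq_sum p v \<le> quad_form p f v}"
  \<comment> \<open>Any lower bound of the form on the unit sphere will do, to show that \<open>T\<close> is nonempty.\<close>
  define K where "K = (\<Sum>i<p. \<Sum>j<p. \<bar>f i j\<bar>)"
  have sq: "sq_sum p v \<ge> 0" for v unfolding sq_sum_def by (simp add: sum_nonneg)
  have "- K * sq_sum p v \<le> quad_form p f v" for v
  proof -
    have "- quad_form p f v \<le> (\<Sum>i<p. \<Sum>j<p. \<bar>f i j\<bar> * sq_sum p v)"
      unfolding quad_form_def sum_negf[symmetric]
    proof (intro sum_mono)
      fix i j assume ij: "i \<in> {..<p}" "j \<in> {..<p}"
      have *: "(v i)\<^sup>2 \<le> sq_sum p v" "(v j)\<^sup>2 \<le> sq_sum p v"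
        unfolding sq_sum_def using ij by (auto intro!: member_le_sum)
      have "2 * \<bar>v i * v j\<bar> \<le> (v i)\<^sup>2 + (v j)\<^sup>2"
        using sum_squares_bound[of "\<bar>v i\<bar>" "\<bar>v j\<bar>"] by (simp add: abs_mult)
      hence "\<bar>v i * v j\<bar> \<le> sq_sum p v" using * by linarith
      hence "\<bar>f i j\<bar> * \<bar>v i * v j\<bar> \<le> \<bar>f i j\<bar> * sq_sum p v" by (intro mult_left_mono) auto
      moreover have "- (f i j * v i * v j) \<le> \<bar>f i j\<bar> * \<bar>v i * v j\<bar>"
        using abs_ge_minus_self[of "f i j * v i * v j"] by (simp add: abs_mult mult.assoc)
      ultimately show "- (f i j * v i * v j) \<le> \<bar>f i j\<bar> * sq_sum p v" by linarith
    qed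
    thus ?thesis by (simp add: K_def sum_distrib_right)
  qed
  hence "- K \<in> T" by (simp add: T_def)
  hence ne: "T \<noteq> {}" by blast
  have one: "sq_sum p (\<lambda>j. if j = 0 then 1 else 0) = 1"
    unfolding sq_sum_def using p by (simp add: if_distrib[of "\<lambda>x. x\<^sup>2"] cong: if_cong)
  have ub: "t \<le> f 0 0" if "t \<in> T" for t
  proof -
    have "t * sq_sum p (\<lambda>j. if j = 0 then 1 else 0) \<le> quad_form p f (\<lambda>j. if j = 0 then 1 else 0)"
      using that unfolding T_def by blast
    thus ?thesis using quad_form_unit[of 0 p f] p one by simp
  qed
  hence bdd: "bdd_above T" by (auto simp: bdd_above_def)
  define \<mu> where "\<mu> = Sup T"
  have mu: "\<mu> * sq_sum p v \<le> quad_form p f v" for v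
  proof (cases "sq_sum p v = 0")
    case True
    moreover have "- K * sq_sum p v \<le> quad_form p f v"
      using \<open>- K \<in> T\<close> unfolding T_def by blast
    ultimately show ?thesis by simp
  next
    case False
    hence s: "sq_sum p v > 0" using sq[of v] by simp
    have "\<mu> \<le> quad_form p f v / sq_sum p v"
      unfolding \<mu>_def using ne s by (intro cSup_least) (auto simp: T_def field_simps)
    thus ?thesis using s by (simp add: field_simps)
  qed
  \<comment> \<open>The form of \<open>M - \<mu> I\<close>.\<close>
  define g where "g = (\<lambda>i j. f i j - (if i = j then \<mu> else 0))"
  have gq: "quad_form p g v = quad_form p f v - \<mu> * sq_sum p v" for v
  proof -
    have "quad_form p g v = quad_form p f v - (\<Sum>i<p. \<Sum>j<p. if i = j then \<mu> * v i * v j else 0)"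
      unfolding quad_form_def g_def sum_subtractf[symmetric] by (intro sum.cong) (auto simp: algebra_simps)
    thus ?thesis by (simp add: sq_sum_def sum_distrib_left power2_eq_square mult.assoc)
  qed
  have gs: "sym_entries p g" using f by (auto simp: sym_entries_def g_def)
  have "\<not> pos_def_on p g"
  proof
    assume "pos_def_on p g"
    from pos_def_on_coercive[OF gs this] obtain c where c: "c > 0" "\<And>v. c * sq_sum p v \<le> quad_form p g v"
      by blast
    hence "\<mu> + c \<in> T" by (auto simp: T_def gq algebra_simps)
    hence "\<mu> + c \<le> \<mu>" unfolding \<mu>_def using bdd by (intro cSup_upper)
    thus False using c by simp
  qed
  then obtain v i where i: "i < p" "v i \<noteq> 0" and v: "quad_form p g v \<le> 0"
    unfolding pos_def_on_def by force
  have psd: "0 \<le> quad_form p g w" for w using mu[of w] by (simp add: gq)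
  have null: "(\<Sum>j<p. g i j * v j) = 0" if "i < p" for i
    using psd_null_vector[OF gs psd _ that, of v] v psd[of v] by simp
  have "eigenvector M (vec p v) \<mu>"
    unfolding eigenvector_def
  proof (intro conjI)
    show "vec p v \<in> carrier_vec (dim_row M)" using M by simp
    show "vec p v \<noteq> 0\<^sub>v (dim_row M)" using i M by (metis carrier_matD(1) index_vec index_zero_vec(1))
    show "M *\<^sub>v vec p v = \<mu> \<cdot>\<^sub>v vec p v"
    proof (rule eq_vecI)
      fix i assume "i < dim_vec (\<mu> \<cdot>\<^sub>v vec p v)"
      hence i: "i < p" by simp
      have "(\<Sum>j<p. f i j * v j) - (\<Sum>j<p. (if i = j then \<mu> * v j else 0)) = (\<Sum>j<p. g i j * v j)"
        unfolding sum_subtractf[symmetric] g_def by (intro sum.cong) (auto simp: algebra_simps)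
      hence "(\<Sum>j<p. f i j * v j) = \<mu> * v i" using null[OF i] i by simp
      thus "(M *\<^sub>v vec p v) $ i = (\<mu> \<cdot>\<^sub>v vec p v) $ i"
        using i M by (simp add: scalar_prod_def atLeast0LessThan f_def)
    qed (use M in auto)
  qed
  hence "\<mu> \<in> spectrum M" by (auto simp: spectrum_def eigenvalue_def)
  thus ?thesis using mu unfolding f_def by blast
qed

lemma lambda_min_le_quad_form:
  assumes M: "M \<in> carrier_mat p p" and sym: "M\<^sup>T = M" and p: "p \<ge> 1"
  shows "lambda_min M * sq_sum p v \<le> quad_form p (\<lambda>i j. M $$ (i, j)) v"
proof -
  obtain \<mu> where mu: "\<mu> \<in> spectrum M" "\<And>v. \<mu> * sq_sum p v \<le> quad_form p (\<lambda>i j. M $$ (i, j)) v"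
    using eigenvalue_below_quad_form[OF assms] by blast
  have "lambda_min M \<le> \<mu>"
    unfolding lambda_min_def using mu(1) card_finite_spectrum(1)[OF M] by (intro Min_le)
  hence "lambda_min M * sq_sum p v \<le> \<mu> * sq_sum p v"
    by (intro mult_right_mono) (auto simp: sq_sum_def sum_nonneg)
  with mu(2)[of v] show ?thesis by linarith
qed

lemma quad_form_le_lambda_max:
  assumes M: "M \<in> carrier_mat p p" and sym: "M\<^sup>T = M" and p: "p \<ge> 1"
  shows "quad_form p (\<lambda>i j. M $$ (i, j)) v \<le> lambda_max M * sq_sum p v"
proof -
  have M': "- M \<in> carrier_mat p p" using M by simp
  have sym': "(- M)\<^sup>T = - M" using sym by (metis transpose_uminus)
  obtain \<mu> where mu: "\<mu> \<in> spectrum (- M)" "\<And>v. \<mu> * sq_sum p v \<le> quad_form p (\<lambda>i j. (- M) $$ (i, j)) v"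
    using eigenvalue_below_quad_form[OF M' sym' p] by blast
  have q: "quad_form p (\<lambda>i j. (- M) $$ (i, j)) v = - quad_form p (\<lambda>i j. M $$ (i, j)) v"
    using M by (simp add: quad_form_def sum_negf)
  obtain w where w: "eigenvector (- M) w \<mu>" using mu(1) by (auto simp: spectrum_def eigenvalue_def)
  have wc: "w \<in> carrier_vec p" "- M *\<^sub>v w = \<mu> \<cdot>\<^sub>v w" using w M by (auto simp: eigenvector_def)
  have "M *\<^sub>v w = - (- M *\<^sub>v w)" using M wc(1) by (auto)
  also have "\<dots> = (- \<mu>) \<cdot>\<^sub>v w" using wc by auto
  finally have "eigenvector M w (- \<mu>)" using w M by (auto simp: eigenvector_def)
  hence "- \<mu> \<in> spectrum M" by (auto simp: spectrum_def eigenvalue_def)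
  hence "- \<mu> \<le> lambda_max M"
    unfolding lambda_max_def using card_finite_spectrum(1)[OF M] by (intro Max_ge)
  hence "- \<mu> * sq_sum p v \<le> lambda_max M * sq_sum p v"
    by (intro mult_right_mono) (auto simp: sq_sum_def sum_nonneg)
  with mu(2)[of v] q show ?thesis by linarith
qed

section \<open>Row tails and entry bounds of a bounded Cholesky factorization\<close>

text \<open>
  Truncated subtraction makes this the sum over the \<open>j\<close> with \<open>j + k < i\<close>, the entries more than
  \<open>k\<close> places to the left of the diagonal.
\<close>
definition row_tail :: "(nat \<Rightarrow> nat \<Rightarrow> real) \<Rightarrow> nat \<Rightarrow> nat \<Rightarrow> real" where
  "row_tail l i k = (\<Sum>j<i - k. \<bar>l i j\<bar>)"

lemma geometric_sum_from:
  fixes r :: real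
  assumes "0 \<le> r" "r < 1"
  shows "(\<Sum>m\<in>{Suc i..<p}. r ^ (m - i)) \<le> r / (1 - r)"
proof (cases "Suc i \<le> p")
  case True
  hence "(\<Sum>m\<in>{Suc i..<p}. r ^ (m - i)) = (r - r ^ (p - i)) / (1 - r)"
  proof (induction p rule: dec_induct)
    case (step n)
    have "(\<Sum>m\<in>{Suc i..<Suc n}. r ^ (m - i)) = (r - r ^ (n - i)) / (1 - r) + r ^ (n - i)"
      using step by simp
    also have "\<dots> = (r - r ^ (Suc n - i)) / (1 - r)"
      using step.hyps assms by (simp add: Suc_diff_le field_simps)
    finally show ?case .
  qed simp
  also have "\<dots> \<le> r / (1 - r)" using assms by (intro divide_right_mono) auto
  finally show ?thesis .
qed (use assms in simp)

text \<open>
  A positive definite matrix \<open>w\<close> with spectrum in \<open>[\<epsilon>, 1 / \<epsilon>]\<close>, stated through its quadratic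
  form, and its factorization \<open>l\<^sup>T d\<^sup>-\<^sup>1 l\<close>. In the modified Cholesky decomposition \<open>l = I - A\<close>.
\<close>
locale bounded_cholesky =
  fixes p :: nat and l :: "nat \<Rightarrow> nat \<Rightarrow> real" and d :: "nat \<Rightarrow> real"
    and w :: "nat \<Rightarrow> nat \<Rightarrow> real" and \<epsilon> :: real
  assumes eps: "\<epsilon> > 0"
    and lower: "unit_lower l"
    and d_pos: "m < p \<Longrightarrow> d m > 0"
    and w_eq: "i < p \<Longrightarrow> j < p \<Longrightarrow> w i j = (\<Sum>m<p. l m i * l m j / d m)"
    and form_ge: "\<epsilon> * sq_sum p v \<le> quad_form p w v"
    and form_le: "quad_form p w v \<le> inverse \<epsilon> * sq_sum p v"
begin

lemma l_diag [simp]: "l i i = 1" and l_upper: "i < j \<Longrightarrow> l i j = 0"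
  using lower by (auto simp: unit_lower_def)

text \<open>
  The terms \<open>(l m i)\<^sup>2 / d m\<close> of column \<open>i\<close> are nonnegative and sum up to \<open>w i i\<close>, a value of the
  form at a unit vector.
\<close>
lemma column_term_le:
  assumes "i < p" "m < p"
  shows "(l m i)\<^sup>2 / d m \<le> 1 / \<epsilon>"
proof -
  have "sq_sum p (\<lambda>j. if j = i then 1 else 0) = 1"
    unfolding sq_sum_def using assms by (simp add: if_distrib[of "\<lambda>x. x\<^sup>2"] cong: if_cong)
  hence "w i i \<le> 1 / \<epsilon>"
    using form_le[of "\<lambda>j. if j = i then 1 else 0"] quad_form_unit[OF assms(1), of w]
    by (simp add: divide_inverse)
  moreover have "(l m i)\<^sup>2 / d m \<le> (\<Sum>m<p. (l m i)\<^sup>2 / d m)"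
    using assms d_pos by (intro member_le_sum) (auto simp: less_imp_le)
  ultimately show ?thesis using assms by (simp add: w_eq power2_eq_square)
qed

lemma inverse_d_le: "m < p \<Longrightarrow> 1 / d m \<le> 1 / \<epsilon>"
  using column_term_le[of m m] by simp

lemma quad_form_cholesky:
  "quad_form p w v = (\<Sum>m<p. (\<Sum>i<p. l m i * v i)\<^sup>2 / d m)"
proof -
  have "quad_form p w v = (\<Sum>i<p. \<Sum>j<p. \<Sum>m<p. l m i * v i * (l m j * v j) / d m)"
    unfolding quad_form_def
    by (intro sum.cong refl) (simp add: w_eq sum_distrib_left sum_distrib_right mult_ac)
  also have "\<dots> = (\<Sum>i<p. \<Sum>m<p. \<Sum>j<p. l m i * v i * (l m j * v j) / d m)"
    by (intro sum.cong refl sum.swap)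
  also have "\<dots> = (\<Sum>m<p. \<Sum>i<p. \<Sum>j<p. l m i * v i * (l m j * v j) / d m)"
    by (rule sum.swap)
  also have "\<dots> = (\<Sum>m<p. (\<Sum>i<p. l m i * v i)\<^sup>2 / d m)"
    by (simp add: power2_eq_square sum_product sum_divide_distrib)
  finally show ?thesis .
qed

text \<open>
  Solves \<open>l v = e\<close> for the \<open>m\<close>-th unit vector \<open>e\<close>. The solution has \<open>v m = 1\<close>, hence norm at
  least \<open>1\<close>, while the form takes the value \<open>1 / d m\<close> there.
\<close>
lemma forward_substitution:
  assumes "m < n"
  shows "\<exists>v. v m = 1 \<and> (\<forall>k<n. (\<Sum>i\<le>k. l k i * v i) = (if k = m then 1 else 0))"
  using assms[THEN Suc_leI]
proof (induction n rule: dec_induct)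
  case base
  show ?case
    by (intro exI[of _ "\<lambda>i. if i = m then 1 else 0"])
       (auto simp: if_distrib[of "\<lambda>x. _ * x"] cong: if_cong)
next
  case (step n)
  then obtain v where v: "v m = 1" "\<And>k. k < n \<Longrightarrow> (\<Sum>i\<le>k. l k i * v i) = (if k = m then 1 else 0)"
    by blast
  define u where "u = v(n := - (\<Sum>i<n. l n i * v i))"
  have "(\<Sum>i\<le>k. l k i * u i) = (if k = m then 1 else 0)" if "k < Suc n" for k
  proof (cases "k = n")
    case True
    thus ?thesis using step.hyps by (simp add: lessThan_Suc_atMost[symmetric] u_def)
  next
    case False
    hence "k < n" using that by simp
    moreover have "(\<Sum>i\<le>k. l k i * u i) = (\<Sum>i\<le>k. l k i * v i)"
      using \<open>k < n\<close> by (intro sum.cong) (auto simp: u_def)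
    ultimately show ?thesis using v(2) by simp
  qed
  moreover have "u m = 1" using v(1) step.hyps by (simp add: u_def)
  ultimately show ?case by blast
qed

lemma d_le:
  assumes "m < p"
  shows "d m \<le> 1 / \<epsilon>"
proof -
  obtain v where v: "v m = 1" "\<And>k. k < p \<Longrightarrow> (\<Sum>i\<le>k. l k i * v i) = (if k = m then 1 else 0)"
    using forward_substitution[OF assms] by blast
  have "(\<Sum>i<p. l k i * v i) = (if k = m then 1 else 0)" if "k < p" for k
  proof -
    have "(\<Sum>i<p. l k i * v i) = (\<Sum>i\<le>k. l k i * v i)"
      using that l_upper by (intro sum.mono_neutral_right) auto
    thus ?thesis using v(2)[OF that] by simp
  qed
  hence "quad_form p w v = (\<Sum>k<p. if k = m then 1 / d m else 0)"
    unfolding quad_form_cholesky by (intro sum.cong) auto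
  hence "quad_form p w v = 1 / d m" using assms by simp
  moreover have "1 \<le> sq_sum p v"
    unfolding sq_sum_def using member_le_sum[of m "{..<p}" "\<lambda>i. (v i)\<^sup>2"] assms v(1) by simp
  hence "\<epsilon> \<le> \<epsilon> * sq_sum p v" using eps by simp
  ultimately have "\<epsilon> \<le> 1 / d m" using form_ge[of v] by linarith
  thus ?thesis using eps d_pos[OF assms] by (simp add: field_simps)
qed

text \<open>
  The bounds on \<open>(l m i)\<^sup>2 / d m\<close> and on \<open>1 / d m\<close> multiply to this one. It controls the weights in
  the recursion for the tails and thereby fixes the admissible decay rate.
\<close>
lemma abs_l_div_d_le:
  assumes "i < p" "m < p"
  shows "\<bar>l m i\<bar> / d m \<le> 1 / \<epsilon>"
proof -
  have "(\<bar>l m i\<bar> / d m)\<^sup>2 = (l m i)\<^sup>2 / d m * (1 / d m)"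
    by (simp add: power2_eq_square)
  also have "\<dots> \<le> 1 / \<epsilon> * (1 / \<epsilon>)"
    using column_term_le[OF assms] inverse_d_le[OF assms(2)] d_pos[OF assms(2)] eps
    by (intro mult_mono) auto
  finally have "(\<bar>l m i\<bar> / d m)\<^sup>2 \<le> (1 / \<epsilon>)\<^sup>2" by (simp add: power2_eq_square)
  thus ?thesis by (rule power2_le_imp_le) (use eps in simp)
qed

lemma abs_l_le:
  assumes "i < p" "m < p"
  shows "\<bar>l m i\<bar> \<le> 1 / \<epsilon>"
proof -
  have "(\<bar>l m i\<bar>)\<^sup>2 = (l m i)\<^sup>2 / d m * d m"
    using d_pos[OF assms(2)] by simp
  also have "\<dots> \<le> 1 / \<epsilon> * (1 / \<epsilon>)"
    using column_term_le[OF assms] d_le[OF assms(2)] d_pos[OF assms(2)] eps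
    by (intro mult_mono) auto
  finally have "(\<bar>l m i\<bar>)\<^sup>2 \<le> (1 / \<epsilon>)\<^sup>2" by (simp add: power2_eq_square)
  thus ?thesis by (rule power2_le_imp_le) (use eps in simp)
qed

section \<open>From the factor to the matrix\<close>

lemma w_eq_from:
  assumes "i < p" "j < p" "n \<le> i \<or> n \<le> j"
  shows "w i j = (\<Sum>m\<in>{n..<p}. l m i * l m j / d m)"
  unfolding w_eq[OF assms(1,2)]
  using assms(3) l_upper by (intro sum.mono_neutral_right) auto

lemma abs_w_le:
  assumes "i < p" "j < p" "n \<le> i \<or> n \<le> j"
  shows "\<bar>w i j\<bar> \<le> (\<Sum>m\<in>{n..<p}. \<bar>l m i\<bar> / d m * \<bar>l m j\<bar>)"
proof -
  have "\<bar>w i j\<bar> \<le> (\<Sum>m\<in>{n..<p}. \<bar>l m i * l m j / d m\<bar>)"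
    unfolding w_eq_from[OF assms] by (rule sum_abs)
  also have "\<dots> = (\<Sum>m\<in>{n..<p}. \<bar>l m i\<bar> / d m * \<bar>l m j\<bar>)"
    using d_pos by (intro sum.cong) (auto simp: abs_mult abs_divide abs_of_pos)
  finally show ?thesis .
qed

text \<open>
  Entry \<open>w i j\<close> only involves rows \<open>m \<ge> i\<close> of the factor, and the columns \<open>j < i - k\<close> are
  \<open>k + (m - i)\<close> places away from the diagonal in row \<open>m\<close>. The tails therefore add up along the
  sequence \<open>g k, g (k + 1), \<dots>\<close>, whose partial sums are bounded by a multiple of \<open>g k\<close>.
\<close>
lemma w_left_tail_le:
  assumes i: "i < p" and k: "k \<ge> 1"
    and l: "\<And>i k. i < p \<Longrightarrow> k \<ge> 1 \<Longrightarrow> row_tail l i k \<le> c * g k"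
    and K: "\<And>n. (\<Sum>t<n. g (k + t)) \<le> K * g k" and c: "c \<ge> 0"
  shows "row_tail w i k \<le> c / \<epsilon> * (K * g k)"
proof -
  have "row_tail w i k \<le> (\<Sum>j<i - k. \<Sum>m\<in>{i..<p}. \<bar>l m i\<bar> / d m * \<bar>l m j\<bar>)"
    unfolding row_tail_def using i by (intro sum_mono abs_w_le) auto
  also have "\<dots> = (\<Sum>m\<in>{i..<p}. \<bar>l m i\<bar> / d m * row_tail l m (k + (m - i)))"
    by (subst sum.swap) (auto simp: row_tail_def sum_distrib_left intro!: sum.cong)
  also have "\<dots> \<le> (\<Sum>m\<in>{i..<p}. 1 / \<epsilon> * (c * g (k + (m - i))))"
    using i k eps
    by (intro sum_mono mult_mono abs_l_div_d_le l) (auto simp: row_tail_def sum_nonneg)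
  also have "\<dots> = c / \<epsilon> * (\<Sum>m\<in>{i..<p}. g (k + (m - i)))"
    by (simp add: sum_distrib_left)
  also have "(\<Sum>m\<in>{i..<p}. g (k + (m - i))) = (\<Sum>t<p - i. g (k + t))"
    by (rule sum.reindex_bij_witness[of _ "\<lambda>t. i + t" "\<lambda>m. m - i"]) auto
  also have "c / \<epsilon> * \<dots> \<le> c / \<epsilon> * (K * g k)"
    using K c eps by (intro mult_left_mono) auto
  finally show ?thesis .
qed

text \<open>
  Entry \<open>w i j\<close> with \<open>j > i + k\<close> only involves rows \<open>m \<ge> j\<close>, where the factor \<open>l m i\<close> already lies
  in the tail beyond \<open>m - i - 1 \<ge> k\<close>; the other factors \<open>l m j\<close> are bounded by the whole row sum.
\<close>
lemma w_right_tail_le: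
  assumes i: "i < p" and k: "k \<ge> 1"
    and l: "\<And>i k. i < p \<Longrightarrow> k \<ge> 1 \<Longrightarrow> row_tail l i k \<le> c * g k"
    and K: "\<And>n. (\<Sum>t<n. g (k + t)) \<le> K * g k" and c: "0 \<le> c" "c \<le> 1" and g: "g 1 \<ge> 0"
  shows "(\<Sum>j\<in>{Suc (i + k)..<p}. \<bar>w i j\<bar>) \<le> c / \<epsilon> * (1 + 1 / \<epsilon> + g 1) * (K * g k)"
proof -
  let ?R = "1 + 1 / \<epsilon> + g 1"
  have row: "(\<Sum>j<p. \<bar>l m j\<bar>) \<le> ?R" if m: "m < p" for m
  proof -
    have "(\<Sum>j<p. \<bar>l m j\<bar>) = (\<Sum>j<Suc m. \<bar>l m j\<bar>)"
      using m l_upper by (intro sum.mono_neutral_right) auto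
    also have "\<dots> = 1 + (\<Sum>j<m. \<bar>l m j\<bar>)" by simp
    also have "(\<Sum>j<m. \<bar>l m j\<bar>) \<le> 1 / \<epsilon> + row_tail l m 1"
    proof (cases m)
      case 0
      thus ?thesis using eps by (simp add: row_tail_def)
    next
      case (Suc n)
      thus ?thesis using abs_l_le[of n m] m by (simp add: row_tail_def)
    qed
    also have "row_tail l m 1 \<le> g 1"
      using l[OF m, of 1] mult_left_le_one_le[OF g c] by simp
    finally show ?thesis by simp
  qed
  have near: "\<bar>l m i\<bar> / d m \<le> 1 / \<epsilon> * (c * g (m - Suc i))" if m: "Suc (i + k) \<le> m" "m < p" for m
  proof -
    have "m - (m - Suc i) = Suc i" using m by simp
    hence "\<bar>l m i\<bar> \<le> row_tail l m (m - Suc i)"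
      unfolding row_tail_def by (auto intro: member_le_sum)
    also have "\<dots> \<le> c * g (m - Suc i)" using m k by (intro l) auto
    finally have "(1 / d m) * \<bar>l m i\<bar> \<le> (1 / \<epsilon>) * (c * g (m - Suc i))"
      using inverse_d_le[OF m(2)] eps by (intro mult_mono) auto
    thus ?thesis by simp
  qed
  have "(\<Sum>j\<in>{Suc (i + k)..<p}. \<bar>w i j\<bar>)
      \<le> (\<Sum>j\<in>{Suc (i + k)..<p}. \<Sum>m\<in>{Suc (i + k)..<p}. \<bar>l m i\<bar> / d m * \<bar>l m j\<bar>)"
    using i by (intro sum_mono abs_w_le) auto
  also have "\<dots> = (\<Sum>m\<in>{Suc (i + k)..<p}. \<bar>l m i\<bar> / d m * (\<Sum>j\<in>{Suc (i + k)..<p}. \<bar>l m j\<bar>))"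
    by (subst sum.swap) (simp add: sum_distrib_left)
  also have "\<dots> \<le> (\<Sum>m\<in>{Suc (i + k)..<p}. (1 / \<epsilon> * (c * g (m - Suc i))) * ?R)"
  proof (intro sum_mono mult_mono near)
    fix m assume m: "m \<in> {Suc (i + k)..<p}"
    have "(\<Sum>j\<in>{Suc (i + k)..<p}. \<bar>l m j\<bar>) \<le> (\<Sum>j<p. \<bar>l m j\<bar>)"
      by (intro sum_mono2) auto
    also have "\<dots> \<le> ?R" using m by (intro row) auto
    finally show "(\<Sum>j\<in>{Suc (i + k)..<p}. \<bar>l m j\<bar>) \<le> ?R" .
    have "0 \<le> \<bar>l m i\<bar> / d m" using m d_pos[of m] by simp
    also have "\<dots> \<le> 1 / \<epsilon> * (c * g (m - Suc i))" using m by (intro near) auto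
    finally show "0 \<le> 1 / \<epsilon> * (c * g (m - Suc i))" .
  qed (auto simp: sum_nonneg)
  also have "\<dots> = c / \<epsilon> * ?R * (\<Sum>m\<in>{Suc (i + k)..<p}. g (m - Suc i))"
    by (simp add: sum_distrib_left sum_divide_distrib mult_ac)
  also have "(\<Sum>m\<in>{Suc (i + k)..<p}. g (m - Suc i)) = (\<Sum>t<p - Suc (i + k). g (k + t))"
    by (rule sum.reindex_bij_witness[of _ "\<lambda>t. Suc (i + k) + t" "\<lambda>m. m - Suc (i + k)"]) auto
  also have "c / \<epsilon> * ?R * \<dots> \<le> c / \<epsilon> * ?R * (K * g k)"
    using K c g eps by (intro mult_left_mono) auto
  finally show ?thesis .
qed

section \<open>From the matrix to the factor\<close>

text \<open>
  Solving \<open>w i j = l i j / d i + (\<Sum>m>i. l m i * l m j / d m)\<close> for \<open>l i j\<close> expresses a row of the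
  factor by the matrix and by the later rows. The shift \<open>m - i\<close> keeps the set of columns fixed.
\<close>
lemma tail_recursion:
  assumes i: "i < p"
  shows "row_tail l i k \<le> d i * (row_tail w i k + (\<Sum>m\<in>{Suc i..<p}. \<bar>l m i\<bar> / d m * row_tail l m (k + (m - i))))"
proof -
  have entry: "\<bar>l i j\<bar> \<le> d i * (\<bar>w i j\<bar> + (\<Sum>m\<in>{Suc i..<p}. \<bar>l m i\<bar> / d m * \<bar>l m j\<bar>))"
    if j: "j < i - k" for j
  proof -
    let ?s = "\<Sum>m\<in>{Suc i..<p}. l m i * l m j / d m"
    have "w i j = l i j / d i + ?s"
      using i j by (subst w_eq_from[of _ _ i]) (auto simp: sum.atLeast_Suc_lessThan)
    hence "l i j = d i * (w i j - ?s)" using d_pos[OF i] by (simp add: field_simps)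
    hence "\<bar>l i j\<bar> = d i * \<bar>w i j - ?s\<bar>" using d_pos[OF i] by (simp add: abs_mult)
    also have "\<dots> \<le> d i * (\<bar>w i j\<bar> + (\<Sum>m\<in>{Suc i..<p}. \<bar>l m i\<bar> / d m * \<bar>l m j\<bar>))"
    proof (rule mult_left_mono)
      have "\<bar>?s\<bar> \<le> (\<Sum>m\<in>{Suc i..<p}. \<bar>l m i * l m j / d m\<bar>)" by (rule sum_abs)
      also have "\<dots> = (\<Sum>m\<in>{Suc i..<p}. \<bar>l m i\<bar> / d m * \<bar>l m j\<bar>)"
        using d_pos by (intro sum.cong) (auto simp: abs_mult abs_divide abs_of_pos)
      finally show "\<bar>w i j - ?s\<bar> \<le> \<bar>w i j\<bar> + (\<Sum>m\<in>{Suc i..<p}. \<bar>l m i\<bar> / d m * \<bar>l m j\<bar>)"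
        by linarith
    qed (use d_pos[OF i] in simp)
    finally show ?thesis .
  qed
  have "row_tail l i k \<le> (\<Sum>j<i - k. d i * (\<bar>w i j\<bar> + (\<Sum>m\<in>{Suc i..<p}. \<bar>l m i\<bar> / d m * \<bar>l m j\<bar>)))"
    unfolding row_tail_def using entry by (intro sum_mono) auto
  also have "\<dots> = d i * (row_tail w i k + (\<Sum>j<i - k. \<Sum>m\<in>{Suc i..<p}. \<bar>l m i\<bar> / d m * \<bar>l m j\<bar>))"
    by (simp add: row_tail_def sum_distrib_left sum.distrib distrib_left)
  also have "(\<Sum>j<i - k. \<Sum>m\<in>{Suc i..<p}. \<bar>l m i\<bar> / d m * \<bar>l m j\<bar>)
      = (\<Sum>m\<in>{Suc i..<p}. \<bar>l m i\<bar> / d m * row_tail l m (k + (m - i)))"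
    by (subst sum.swap) (auto simp: row_tail_def sum_distrib_left intro!: sum.cong)
  finally show ?thesis .
qed

text \<open>
  Backward induction on the row. If all later tails are at most \<open>K * r ^ k\<close>, the recursion gives
  \<open>(C / \<epsilon> + q * K) * r ^ k\<close> with \<open>q = r / (\<epsilon>\<^sup>2 * (1 - r))\<close>: one factor \<open>1 / \<epsilon>\<close> comes from \<open>d i\<close>, one from
  the weights \<open>\<bar>l m i\<bar> / d m\<close>, and \<open>r / (1 - r)\<close> from the shifts. For \<open>q < 1\<close> the bound reproduces
  itself with \<open>K = C / \<epsilon> / (1 - q)\<close>.
\<close>
lemma l_tail_geometric:
  assumes r: "0 \<le> r" "r < 1" and C: "C \<ge> 0"
    and q: "r / (\<epsilon>\<^sup>2 * (1 - r)) < 1"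
    and w: "\<And>i k. i < p \<Longrightarrow> k \<ge> 1 \<Longrightarrow> row_tail w i k \<le> C * r ^ k"
    and i: "i < p" and k: "k \<ge> 1"
  shows "row_tail l i k \<le> C / \<epsilon> / (1 - r / (\<epsilon>\<^sup>2 * (1 - r))) * r ^ k"
  using i k
proof (induction "p - i" arbitrary: i k rule: less_induct)
  case less
  define q where "q = r / (\<epsilon>\<^sup>2 * (1 - r))"
  define K where "K = C / \<epsilon> / (1 - q)"
  have q1: "q < 1" using q by (simp add: q_def)
  have K0: "K \<ge> 0" using q1 C eps by (simp add: K_def)
  have "row_tail l i k \<le> d i * (row_tail w i k + (\<Sum>m\<in>{Suc i..<p}. \<bar>l m i\<bar> / d m * row_tail l m (k + (m - i))))"
    by (rule tail_recursion[OF less.prems(1)])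
  also have "\<dots> \<le> 1 / \<epsilon> * (C * r ^ k + (\<Sum>m\<in>{Suc i..<p}. 1 / \<epsilon> * (K * r ^ (k + (m - i)))))"
  proof (intro mult_mono add_mono sum_mono)
    fix m assume m: "m \<in> {Suc i..<p}"
    show "\<bar>l m i\<bar> / d m \<le> 1 / \<epsilon>" using m less.prems by (intro abs_l_div_d_le) auto
    show "row_tail l m (k + (m - i)) \<le> K * r ^ (k + (m - i))"
      unfolding K_def q_def by (rule less.hyps) (use m less.prems in auto)
  qed (use less.prems d_le w eps d_pos in \<open>auto simp: row_tail_def intro!: sum_nonneg add_nonneg_nonneg mult_nonneg_nonneg divide_nonneg_nonneg simp: less_imp_le\<close>)
  also have "\<dots> = C / \<epsilon> * r ^ k + (1 / \<epsilon>\<^sup>2) * K * r ^ k * (\<Sum>m\<in>{Suc i..<p}. r ^ (m - i))"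
    unfolding power_add by (simp add: sum_distrib_left power2_eq_square algebra_simps)
  also have "\<dots> \<le> C / \<epsilon> * r ^ k + (1 / \<epsilon>\<^sup>2) * K * r ^ k * (r / (1 - r))"
    using geometric_sum_from[OF r, of i p] K0 r by (intro add_left_mono mult_left_mono) auto
  also have "\<dots> = (C / \<epsilon> + q * K) * r ^ k" by (simp add: q_def algebra_simps)
  also have "C / \<epsilon> = K * (1 - q)" using q1 by (simp add: K_def)
  also have "K * (1 - q) + q * K = K" by (simp add: algebra_simps)
  finally show ?case unfolding K_def q_def .
qed

text \<open>
  The recursion expresses tails beyond \<open>n\<close> by tails that also lie beyond \<open>n\<close>.
\<close>
lemma l_tail_banded:
  assumes w: "\<And>i k. i < p \<Longrightarrow> n \<le> k \<Longrightarrow> row_tail w i k = 0"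
    and i: "i < p" and k: "n \<le> k"
  shows "row_tail l i k = 0"
  using i k
proof (induction "p - i" arbitrary: i k rule: less_induct)
  case less
  have "(\<Sum>m\<in>{Suc i..<p}. \<bar>l m i\<bar> / d m * row_tail l m (k + (m - i))) = 0"
    using less by (intro sum.neutral) auto
  hence "row_tail l i k \<le> 0"
    using tail_recursion[OF less.prems(1), of k] w[OF less.prems] by simp
  moreover have "row_tail l i k \<ge> 0" by (simp add: row_tail_def sum_nonneg)
  ultimately show ?case by simp
qed

text \<open>
  At most \<open>n\<close> nonzero entries lie to the left of the diagonal in row \<open>i\<close>.
\<close>
lemma l_tail_le_band_width:
  assumes zero: "row_tail l i n = 0" and i: "i < p"
  shows "row_tail l i k \<le> n / \<epsilon>"
proof -
  have "row_tail l i k \<le> (\<Sum>j<i. \<bar>l i j\<bar>)"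
    unfolding row_tail_def by (intro sum_mono2) auto
  also have "{..<i} = {..<i - n} \<union> {i - n..<i}" by auto
  also have "(\<Sum>j\<in>\<dots>. \<bar>l i j\<bar>) = row_tail l i n + (\<Sum>j\<in>{i - n..<i}. \<bar>l i j\<bar>)"
    unfolding row_tail_def by (intro sum.union_disjoint) auto
  also have "\<dots> = (\<Sum>j\<in>{i - n..<i}. \<bar>l i j\<bar>)" using zero by simp
  also have "\<dots> \<le> (\<Sum>j\<in>{i - n..<i}. 1 / \<epsilon>)"
    using i by (intro sum_mono abs_l_le) auto
  also have "\<dots> = real (i - (i - n)) / \<epsilon>" by simp
  also have "\<dots> \<le> n / \<epsilon>" using eps by (intro divide_right_mono) auto
  finally show ?thesis .
qed

end

section \<open>Translation to matrices\<close>

text \<open>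
  The factor \<open>I - A\<close> of the decomposition, with the entries above the diagonal set to \<open>0\<close> at all
  indices, so that it is unit lower triangular without reference to a dimension.
\<close>
definition mcd_factor :: "real mat \<Rightarrow> nat \<Rightarrow> nat \<Rightarrow> real" where
  "mcd_factor A i j = (if i = j then 1 else if j < i then - A $$ (i, j) else 0)"

lemma unit_lower_mcd_factor: "unit_lower (mcd_factor A)"
  by (simp add: unit_lower_def mcd_factor_def)

lemma mult_mat_entry:
  assumes "X \<in> carrier_mat p p" "Y \<in> carrier_mat p p" "i < p" "j < p"
  shows "(X * Y) $$ (i, j) = (\<Sum>m<p. X $$ (i, m) * Y $$ (m, j))"
  using assms by (simp add: scalar_prod_def atLeast0LessThan)

text \<open>
  The matrix inverse of \<open>D\<close> in the decomposition is the diagonal matrix of the reciprocals, by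
  uniqueness of inverses; the rest is entrywise evaluation of the product.
\<close>
lemma is_mcd_iff:
  assumes M: "M \<in> carrier_mat p p"
  shows "is_mcd p M A D \<longleftrightarrow>
     A \<in> carrier_mat p p \<and> (\<forall>i<p. \<forall>j<p. i \<le> j \<longrightarrow> A $$ (i, j) = 0) \<and>
     D \<in> carrier_mat p p \<and> diagonal_mat D \<and> (\<forall>i<p. D $$ (i, i) > 0) \<and>
     (\<forall>i<p. \<forall>j<p. M $$ (i, j) = (\<Sum>m<p. mcd_factor A m i * mcd_factor A m j / D $$ (m, m)))"
proof (cases "A \<in> carrier_mat p p \<and> (\<forall>i<p. \<forall>j<p. i \<le> j \<longrightarrow> A $$ (i, j) = 0) \<and>
     D \<in> carrier_mat p p \<and> diagonal_mat D \<and> (\<forall>i<p. D $$ (i, i) > 0)")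
  case True
  hence A: "A \<in> carrier_mat p p" and strict: "\<And>i j. i < p \<Longrightarrow> j < p \<Longrightarrow> i \<le> j \<Longrightarrow> A $$ (i, j) = 0"
    and D: "D \<in> carrier_mat p p" and diag: "diagonal_mat D" and pos: "\<And>i. i < p \<Longrightarrow> D $$ (i, i) > 0"
    by auto
  let ?L = "1\<^sub>m p - A"
  define E where "E = mat p p (\<lambda>(i, j). if i = j then 1 / D $$ (i, i) else 0)"
  have E: "E \<in> carrier_mat p p" by (simp add: E_def)
  have L: "?L \<in> carrier_mat p p" using A by (metis minus_carrier_mat)
  have L_entry: "?L $$ (i, j) = mcd_factor A i j" if "i < p" "j < p" for i j
    using that A strict by (auto simp: mcd_factor_def)
  have off: "D $$ (i, j) = 0" if "i < p" "j < p" "i \<noteq> j" for i j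
    using diag D that by (auto simp: diagonal_mat_def)
  have DE: "D * E = 1\<^sub>m p"
  proof (rule eq_matI)
    fix i j assume ij: "i < dim_row (1\<^sub>m p :: real mat)" "j < dim_col (1\<^sub>m p :: real mat)"
    have "(D * E) $$ (i, j) = (\<Sum>m<p. D $$ (i, m) * E $$ (m, j))"
      using ij by (intro mult_mat_entry[OF D E]) auto
    also have "\<dots> = (\<Sum>m<p. if m = j then D $$ (i, j) / D $$ (j, j) else 0)"
      using ij by (intro sum.cong) (auto simp: E_def)
    also have "\<dots> = 1\<^sub>m p $$ (i, j)"
      using ij pos[of j] off[of i j] by auto
    finally show "(D * E) $$ (i, j) = 1\<^sub>m p $$ (i, j)" .
  qed (use D E in auto)
  have ED: "E * D = 1\<^sub>m p" by (rule mat_mult_left_right_inverse[OF D E DE])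
  have unique: "F = E" if "F \<in> carrier_mat p p" "F * D = 1\<^sub>m p" for F
  proof -
    have "F = F * (D * E)" using DE that by simp
    also have "\<dots> = F * D * E" using that D E by (intro assoc_mult_mat[symmetric]) auto
    also have "\<dots> = E" using that E by simp
    finally show ?thesis .
  qed
  have entries: "(?L\<^sup>T * E * ?L) $$ (i, j) = (\<Sum>m<p. mcd_factor A m i * mcd_factor A m j / D $$ (m, m))"
    if ij: "i < p" "j < p" for i j
  proof -
    have LE: "(?L\<^sup>T * E) $$ (i, m) = mcd_factor A m i / D $$ (m, m)" if m: "m < p" for m
    proof -
      have "(?L\<^sup>T * E) $$ (i, m) = (\<Sum>n<p. ?L $$ (n, i) * E $$ (n, m))"
        using ij m L by (subst mult_mat_entry[of _ p, OF _ E]) (auto simp del: index_minus_mat)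
      also have "\<dots> = (\<Sum>n<p. if n = m then mcd_factor A m i / D $$ (m, m) else 0)"
        using ij m L_entry by (intro sum.cong) (auto simp: E_def simp del: index_minus_mat)
      finally show ?thesis using m by simp
    qed
    have "(?L\<^sup>T * E * ?L) $$ (i, j) = (\<Sum>m<p. (?L\<^sup>T * E) $$ (i, m) * ?L $$ (m, j))"
      by (rule mult_mat_entry[OF _ L ij]) (use L E in auto)
    also have "\<dots> = (\<Sum>m<p. mcd_factor A m i * mcd_factor A m j / D $$ (m, m))"
      using ij LE L_entry by (intro sum.cong) (auto simp del: index_minus_mat)
    finally show ?thesis .
  qed
  have "inverts_mat D E" "inverts_mat E D"
    using DE ED D E by (simp_all add: inverts_mat_def)
  moreover have "F = E" if "F \<in> carrier_mat p p" "inverts_mat F D" for F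
    using unique[OF that(1)] that by (simp add: inverts_mat_def)
  ultimately have "(\<exists>F\<in>carrier_mat p p. inverts_mat D F \<and> inverts_mat F D \<and> M = ?L\<^sup>T * F * ?L)
      \<longleftrightarrow> M = ?L\<^sup>T * E * ?L"
    using E by metis
  hence "is_mcd p M A D \<longleftrightarrow> M = ?L\<^sup>T * E * ?L"
    unfolding is_mcd_def using True by blast
  also have "\<dots> \<longleftrightarrow> (\<forall>i<p. \<forall>j<p. M $$ (i, j) = (\<Sum>m<p. mcd_factor A m i * mcd_factor A m j / D $$ (m, m)))"
  proof
    assume "M = ?L\<^sup>T * E * ?L"
    thus "\<forall>i<p. \<forall>j<p. M $$ (i, j) = (\<Sum>m<p. mcd_factor A m i * mcd_factor A m j / D $$ (m, m))"
      using entries by simp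
  next
    assume *: "\<forall>i<p. \<forall>j<p. M $$ (i, j) = (\<Sum>m<p. mcd_factor A m i * mcd_factor A m j / D $$ (m, m))"
    show "M = ?L\<^sup>T * E * ?L"
    proof (rule eq_matI)
      fix i j assume "i < dim_row (?L\<^sup>T * E * ?L)" "j < dim_col (?L\<^sup>T * E * ?L)"
      hence "i < p" "j < p" using A by auto
      thus "M $$ (i, j) = (?L\<^sup>T * E * ?L) $$ (i, j)" using * entries by simp
    qed (use M A in auto)
  qed
  finally show ?thesis using True by simp
next
  case False
  thus ?thesis unfolding is_mcd_def by blast
qed

text \<open>
  As \<open>A\<close> vanishes on and above the diagonal, only the left part of a row survives outside the band.
\<close>
lemma norm_inf_minus_band_mat_le_iff:
  assumes A: "A \<in> carrier_mat p p" and strict: "\<forall>i<p. \<forall>j<p. i \<le> j \<longrightarrow> A $$ (i, j) = 0"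
    and p: "p \<ge> 1"
  shows "norm_inf_mat (A - band_mat k A) \<le> c \<longleftrightarrow> (\<forall>i<p. row_tail (mcd_factor A) i k \<le> c)"
proof -
  have row: "(\<Sum>j<p. \<bar>(A - band_mat k A) $$ (i, j)\<bar>) = row_tail (mcd_factor A) i k" if i: "i < p" for i
  proof -
    have "(\<Sum>j<p. \<bar>(A - band_mat k A) $$ (i, j)\<bar>) = (\<Sum>j<i - k. \<bar>(A - band_mat k A) $$ (i, j)\<bar>)"
      using i A strict by (intro sum.mono_neutral_right) (auto simp: band_mat_def)
    also have "\<dots> = row_tail (mcd_factor A) i k"
      unfolding row_tail_def using i A by (intro sum.cong) (auto simp: band_mat_def mcd_factor_def)
    finally show ?thesis .
  qed
  have dims: "dim_row (A - band_mat k A) = p" "dim_col (A - band_mat k A) = p"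
    using A by (auto simp: band_mat_def)
  have ne: "{..<p} \<noteq> {}" using p by (cases p) auto
  have "norm_inf_mat (A - band_mat k A) \<le> c \<longleftrightarrow> (\<forall>i<p. (\<Sum>j<p. \<bar>(A - band_mat k A) $$ (i, j)\<bar>) \<le> c)"
    unfolding norm_inf_mat_def dims using ne by (subst Max_le_iff) auto
  thus ?thesis using row by auto
qed

lemma Max_off_band_le_iff:
  fixes M :: "real mat"
  assumes p: "p \<ge> 1"
  shows "Max ((\<lambda>i. \<Sum>j | j < p \<and> \<bar>int i - int j\<bar> > int k. \<bar>M $$ (i, j)\<bar>) ` {..<p}) \<le> c \<longleftrightarrow>
    (\<forall>i<p. row_tail (\<lambda>i j. M $$ (i, j)) i k + (\<Sum>j\<in>{Suc (i + k)..<p}. \<bar>M $$ (i, j)\<bar>) \<le> c)"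
proof -
  have row: "(\<Sum>j | j < p \<and> \<bar>int i - int j\<bar> > int k. \<bar>M $$ (i, j)\<bar>)
      = row_tail (\<lambda>i j. M $$ (i, j)) i k + (\<Sum>j\<in>{Suc (i + k)..<p}. \<bar>M $$ (i, j)\<bar>)" if "i < p" for i
  proof -
    have "{j. j < p \<and> \<bar>int i - int j\<bar> > int k} = {..<i - k} \<union> {Suc (i + k)..<p}"
      using that by auto
    moreover have "{..<i - k} \<inter> {Suc (i + k)..<p} = {}" by auto
    ultimately show ?thesis unfolding row_tail_def by (simp add: sum.union_disjoint)
  qed
  have ne: "{..<p} \<noteq> {}" using p by (cases p) auto
  have "Max ((\<lambda>i. \<Sum>j | j < p \<and> \<bar>int i - int j\<bar> > int k. \<bar>M $$ (i, j)\<bar>) ` {..<p}) \<le> c \<longleftrightarrow>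
    (\<forall>i<p. (\<Sum>j | j < p \<and> \<bar>int i - int j\<bar> > int k. \<bar>M $$ (i, j)\<bar>) \<le> c)"
    using ne by (subst Max_le_iff) auto
  thus ?thesis using row by auto
qed

section \<open>Comparison of the two classes\<close>

lemma row_tail_eq_0: "i < p \<Longrightarrow> k \<ge> p - 1 \<Longrightarrow> row_tail l i k = 0"
  by (simp add: row_tail_def)

lemma bounded_cholesky_of_mcd:
  assumes M: "pos_def_mat p M" and p: "p \<ge> 1" and eps: "\<epsilon> > 0"
    and lam: "\<epsilon> \<le> lambda_min M" "lambda_max M \<le> inverse \<epsilon>" and mcd: "is_mcd p M A D"
  shows "bounded_cholesky p (mcd_factor A) (\<lambda>m. D $$ (m, m)) (\<lambda>i j. M $$ (i, j)) \<epsilon>"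
proof
  have Mc: "M \<in> carrier_mat p p" "M\<^sup>T = M" using M by (auto simp: pos_def_mat_def)
  have sq: "sq_sum p v \<ge> 0" for v by (simp add: sq_sum_def sum_nonneg)
  show "\<epsilon> * sq_sum p v \<le> quad_form p (\<lambda>i j. M $$ (i, j)) v" for v
    using lambda_min_le_quad_form[OF Mc p, of v] mult_right_mono[OF lam(1) sq[of v]] by linarith
  show "quad_form p (\<lambda>i j. M $$ (i, j)) v \<le> inverse \<epsilon> * sq_sum p v" for v
    using quad_form_le_lambda_max[OF Mc p, of v] mult_right_mono[OF lam(2) sq[of v]] by linarith
  show "D $$ (m, m) > 0" if "m < p" for m
    using mcd that unfolding is_mcd_def by blast
  show "M $$ (i, j) = (\<Sum>m<p. mcd_factor A m i * mcd_factor A m j / D $$ (m, m))" if "i < p" "j < p" for i j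
    using mcd that unfolding is_mcd_iff[OF Mc(1)] by blast
qed (use eps unit_lower_mcd_factor in auto)

lemma mcd_exists:
  assumes "pos_def_mat p M"
  shows "\<exists>A D. is_mcd p M A D"
proof -
  let ?f = "\<lambda>i j. M $$ (i, j)"
  have M: "M \<in> carrier_mat p p" and sym: "M\<^sup>T = M"
    and pos: "\<And>v. v \<in> carrier_vec p \<Longrightarrow> v \<noteq> 0\<^sub>v p \<Longrightarrow> v \<bullet> (M *\<^sub>v v) > 0"
    using assms by (auto simp: pos_def_mat_def)
  have "sym_entries p ?f"
    unfolding sym_entries_def using M sym by (metis carrier_matD index_transpose_mat(1))
  moreover have "pos_def_on p ?f"
    unfolding pos_def_on_def quad_form_mat[OF M]
  proof (intro allI impI pos)
    fix v :: "nat \<Rightarrow> real" assume "\<exists>i<p. v i \<noteq> 0"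
    thus "vec p v \<noteq> 0\<^sub>v p" by (metis index_vec index_zero_vec(1))
  qed simp
  ultimately obtain l d where l: "unit_lower l" and d: "\<forall>m<p. d m > 0"
    and f: "\<forall>i<p. \<forall>j<p. M $$ (i, j) = (\<Sum>m<p. l m i * l m j / d m)"
    using cholesky_exists by blast
  define A where "A = mat p p (\<lambda>(i, j). if j < i then - l i j else 0)"
  define D where "D = mat p p (\<lambda>(i, j). if i = j then d i else 0)"
  have factor: "mcd_factor A i j = l i j" if "i < p" "j < p" for i j
    using that l by (auto simp: mcd_factor_def A_def unit_lower_def)
  have "is_mcd p M A D"
    unfolding is_mcd_iff[OF M]
  proof (intro conjI)
    show "\<forall>i<p. \<forall>j<p. M $$ (i, j) = (\<Sum>m<p. mcd_factor A m i * mcd_factor A m j / D $$ (m, m))"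
      using f by (simp add: factor D_def)
  qed (use d in \<open>auto simp: A_def D_def diagonal_mat_def\<close>)
  thus ?thesis by blast
qed

text \<open>
  The left and right tails of \<open>M\<close> are bounded by multiples of \<open>c * g k\<close>, so a small \<open>c\<close> absorbs the
  constants. For \<open>k \<ge> p\<close> the condition on the tails of the factor is vacuous.
\<close>
lemma U_class_subset_Ustar_class:
  assumes eps: "\<epsilon> > 0" and p: "p \<ge> 1" and g: "\<And>k. k \<ge> 1 \<Longrightarrow> g k \<ge> 0"
    and K: "\<And>k n. k \<ge> 1 \<Longrightarrow> (\<Sum>t<n. g (k + t)) \<le> K * g k"
    and c: "0 \<le> c" "c \<le> 1" "c * (K / \<epsilon> * (2 + 1 / \<epsilon> + g 1)) \<le> 1"
  shows "U_class p \<epsilon> (\<lambda>k. c * g k) \<subseteq> Ustar_class p \<epsilon> g"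
proof
  fix M assume M: "M \<in> U_class p \<epsilon> (\<lambda>k. c * g k)"
  then obtain A D where pd: "pos_def_mat p M"
    and lam: "\<epsilon> \<le> lambda_min M" "lambda_min M \<le> lambda_max M" "lambda_max M \<le> inverse \<epsilon>"
    and mcd: "is_mcd p M A D"
    and nrm: "\<And>k. 0 < k \<Longrightarrow> k \<le> p - 1 \<Longrightarrow> norm_inf_mat (A - band_mat k A) \<le> c * g k"
    unfolding U_class_def by blast
  interpret bounded_cholesky p "mcd_factor A" "\<lambda>m. D $$ (m, m)" "\<lambda>i j. M $$ (i, j)" \<epsilon>
    by (rule bounded_cholesky_of_mcd[OF pd p eps lam(1,3) mcd])
  have A: "A \<in> carrier_mat p p" "\<forall>i<p. \<forall>j<p. i \<le> j \<longrightarrow> A $$ (i, j) = 0"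
    using mcd unfolding is_mcd_def by blast+
  have l: "row_tail (mcd_factor A) i k \<le> c * g k" if "i < p" "k \<ge> 1" for i k
  proof (cases "k \<le> p - 1")
    case True
    thus ?thesis using nrm[of k] norm_inf_minus_band_mat_le_iff[OF A p, of k "c * g k"] that by auto
  next
    case False
    thus ?thesis using row_tail_eq_0[of i p k] that g[of k] c(1) by simp
  qed
  have "row_tail (\<lambda>i j. M $$ (i, j)) i k + (\<Sum>j\<in>{Suc (i + k)..<p}. \<bar>M $$ (i, j)\<bar>) \<le> g k"
    if i: "i < p" and k: "k \<ge> 1" for i k
  proof -
    have "row_tail (\<lambda>i j. M $$ (i, j)) i k + (\<Sum>j\<in>{Suc (i + k)..<p}. \<bar>M $$ (i, j)\<bar>)
        \<le> c / \<epsilon> * (K * g k) + c / \<epsilon> * (1 + 1 / \<epsilon> + g 1) * (K * g k)"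
      using K[OF k] g[of 1] c
      by (intro add_mono w_left_tail_le[OF i k l] w_right_tail_le[OF i k l]) auto
    also have "\<dots> = c * (K / \<epsilon> * (2 + 1 / \<epsilon> + g 1)) * g k"
      by (simp add: algebra_simps)
    also have "\<dots> \<le> 1 * g k" using c g[OF k] by (intro mult_right_mono) auto
    finally show ?thesis by simp
  qed
  thus "M \<in> Ustar_class p \<epsilon> g"
    unfolding Ustar_class_def Max_off_band_le_iff[OF p] using pd lam eps by simp
qed

lemma Ustar_class_subset_U_class:
  assumes p: "p \<ge> 1" and g: "\<And>k. k \<ge> 1 \<Longrightarrow> g k \<ge> 0"
    and tails: "\<And>l d w i k. bounded_cholesky p l d w \<epsilon> \<Longrightarrow>
      (\<And>i k. i < p \<Longrightarrow> k \<ge> 1 \<Longrightarrow> row_tail w i k \<le> g k) \<Longrightarrow> i < p \<Longrightarrow> k \<ge> 1 \<Longrightarrow> row_tail l i k \<le> c * g k"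
  shows "Ustar_class p \<epsilon> g \<subseteq> U_class p \<epsilon> (\<lambda>k. c * g k)"
proof
  fix M assume M: "M \<in> Ustar_class p \<epsilon> g"
  hence pd: "pos_def_mat p M" and eps: "\<epsilon> > 0"
    and lam: "\<epsilon> \<le> lambda_min M" "lambda_min M \<le> lambda_max M" "lambda_max M \<le> inverse \<epsilon>"
    and off: "\<And>i k. i < p \<Longrightarrow> 0 < k \<Longrightarrow> k \<le> p - 1 \<Longrightarrow>
      row_tail (\<lambda>i j. M $$ (i, j)) i k + (\<Sum>j\<in>{Suc (i + k)..<p}. \<bar>M $$ (i, j)\<bar>) \<le> g k"
    unfolding Ustar_class_def Max_off_band_le_iff[OF p] by auto
  obtain A D where mcd: "is_mcd p M A D" using mcd_exists[OF pd] by blast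
  have A: "A \<in> carrier_mat p p" "\<forall>i<p. \<forall>j<p. i \<le> j \<longrightarrow> A $$ (i, j) = 0"
    using mcd unfolding is_mcd_def by blast+
  have w: "row_tail (\<lambda>i j. M $$ (i, j)) i k \<le> g k" if "i < p" "k \<ge> 1" for i k
  proof (cases "k \<le> p - 1")
    case True
    have "0 \<le> (\<Sum>j\<in>{Suc (i + k)..<p}. \<bar>M $$ (i, j)\<bar>)" by (simp add: sum_nonneg)
    moreover have "row_tail (\<lambda>i j. M $$ (i, j)) i k + (\<Sum>j\<in>{Suc (i + k)..<p}. \<bar>M $$ (i, j)\<bar>) \<le> g k"
      using that True by (intro off) auto
    ultimately show ?thesis by linarith
  next
    case False
    thus ?thesis using row_tail_eq_0[of i p k] that g[of k] by simp
  qed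
  have "row_tail (mcd_factor A) i k \<le> c * g k" if "i < p" "k \<ge> 1" for i k
    using tails[OF bounded_cholesky_of_mcd[OF pd p eps lam(1,3) mcd] w that] .
  hence "norm_inf_mat (A - band_mat k A) \<le> c * g k" if "0 < k" for k
    using that unfolding norm_inf_minus_band_mat_le_iff[OF A p] by simp
  thus "M \<in> U_class p \<epsilon> (\<lambda>k. c * g k)"
    unfolding U_class_def using pd lam mcd by blast
qed

text \<open>
  What the two shapes of \<open>\<gamma>\<close> in the theorem have in common: partial sums from \<open>k\<close> on are bounded by a multiple of
  \<open>g k\<close>, and tails of the matrix bounded by \<open>g\<close> force tails of the factor bounded by a multiple
  of \<open>g\<close>, with constants independent of the dimension.
\<close>
lemma U_classes_comparable:
  assumes eps: "\<epsilon> > 0" and g: "\<And>k. k \<ge> 1 \<Longrightarrow> g k \<ge> 0"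
    and K: "\<And>k n. k \<ge> 1 \<Longrightarrow> (\<Sum>t<n. g (k + t)) \<le> K * g k" and K0: "K \<ge> 0"
    and c: "c > 0"
    and tails: "\<And>p l d w i k. bounded_cholesky p l d w \<epsilon> \<Longrightarrow>
      (\<And>i k. i < p \<Longrightarrow> k \<ge> 1 \<Longrightarrow> row_tail w i k \<le> g k) \<Longrightarrow> i < p \<Longrightarrow> k \<ge> 1 \<Longrightarrow> row_tail l i k \<le> c * g k"
  shows "\<exists>C\<^sub>1>0. \<exists>C\<^sub>2>0. \<forall>p\<ge>1.
      U_class p \<epsilon> (\<lambda>k. C\<^sub>1 * g k) \<subseteq> Ustar_class p \<epsilon> g \<and>
      Ustar_class p \<epsilon> g \<subseteq> U_class p \<epsilon> (\<lambda>k. C\<^sub>2 * g k)"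
proof -
  define S where "S = K / \<epsilon> * (2 + 1 / \<epsilon> + g 1)"
  have S: "S \<ge> 0" using eps K0 g[of 1] by (simp add: S_def)
  define c1 where "c1 = 1 / (1 + S)"
  have c1: "c1 > 0" "c1 \<le> 1" "c1 * S \<le> 1" using S by (auto simp: c1_def field_simps)
  show ?thesis
  proof (rule exI[of _ c1], intro conjI c1(1), rule exI[of _ c], intro conjI c allI impI)
    fix p :: nat assume p: "p \<ge> 1"
    show "U_class p \<epsilon> (\<lambda>k. c1 * g k) \<subseteq> Ustar_class p \<epsilon> g"
      by (rule U_class_subset_Ustar_class[OF eps p g K]) (use c1 in \<open>auto simp: S_def\<close>)
    show "Ustar_class p \<epsilon> g \<subseteq> U_class p \<epsilon> (\<lambda>k. c * g k)"
      by (rule Ustar_class_subset_U_class[OF p g tails])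
  qed
qed

theorem proposition2p1:
  fixes \<epsilon>\<^sub>0 :: real and \<gamma> :: "nat \<Rightarrow> real"
  assumes "\<epsilon>\<^sub>0 > 0"
    and "antimono_on {1..} \<gamma>"
    and "(\<exists>C \<beta>. C > 0 \<and> \<beta> > ln (1 / \<epsilon>\<^sub>0\<^sup>2 + 1) \<and> (\<forall>k\<ge>1. \<gamma> k = C * exp (- \<beta> * real k)))
       \<or> (\<exists>k\<^sub>0>0. \<forall>k>k\<^sub>0. \<gamma> k = 0)"
  shows "\<exists>C\<^sub>1>0. \<exists>C\<^sub>2>0. \<forall>p\<ge>1.
      U_class p \<epsilon>\<^sub>0 (\<lambda>k. C\<^sub>1 * \<gamma> k) \<subseteq> Ustar_class p \<epsilon>\<^sub>0 \<gamma> \<and>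
      Ustar_class p \<epsilon>\<^sub>0 \<gamma> \<subseteq> U_class p \<epsilon>\<^sub>0 (\<lambda>k. C\<^sub>2 * \<gamma> k)"
  using assms(3)
proof
  assume "\<exists>C \<beta>. C > 0 \<and> \<beta> > ln (1 / \<epsilon>\<^sub>0\<^sup>2 + 1) \<and> (\<forall>k\<ge>1. \<gamma> k = C * exp (- \<beta> * real k))"
  then obtain C \<beta> where C: "C > 0" and \<beta>: "\<beta> > ln (1 / \<epsilon>\<^sub>0\<^sup>2 + 1)"
    and \<gamma>: "\<And>k. k \<ge> 1 \<Longrightarrow> \<gamma> k = C * exp (- \<beta> * real k)" by blast
  define r where "r = exp (- \<beta>)"
  have \<gamma>_r: "\<gamma> k = C * r ^ k" if "k \<ge> 1" for k
    using \<gamma>[OF that] by (simp add: r_def exp_of_nat_mult[symmetric] mult.commute)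
  have r0: "r > 0" by (simp add: r_def)
  have "1 / \<epsilon>\<^sub>0\<^sup>2 + 1 > 0" using assms(1) by (simp add: add_pos_pos)
  hence "1 / \<epsilon>\<^sub>0\<^sup>2 + 1 < exp \<beta>" using \<beta> by (metis exp_ln exp_less_cancel_iff)
  hence "r * (1 / \<epsilon>\<^sub>0\<^sup>2 + 1) < r * exp \<beta>" using r0 by (intro mult_strict_left_mono)
  \<comment> \<open>This is where the lower bound on \<open>\<beta>\<close> is used: it says exactly that the contraction constant
    \<open>q\<close> below is smaller than \<open>1\<close>.\<close>
  hence r: "r / \<epsilon>\<^sub>0\<^sup>2 < 1 - r" by (simp add: r_def exp_minus field_simps)
  have "r / \<epsilon>\<^sub>0\<^sup>2 > 0" using r0 assms(1) by simp
  hence r1: "r < 1" using r by linarith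
  define q where "q = r / (\<epsilon>\<^sub>0\<^sup>2 * (1 - r))"
  have q: "q < 1"
    using r r1 assms(1) by (simp add: q_def field_simps)
  show ?thesis
  proof (rule U_classes_comparable[OF assms(1), of \<gamma> "1 / (1 - r)" "1 / \<epsilon>\<^sub>0 / (1 - q)"])
    show "0 \<le> \<gamma> k" if "k \<ge> 1" for k using that C r0 by (simp add: \<gamma>_r)
    show "(\<Sum>t<n. \<gamma> (k + t)) \<le> 1 / (1 - r) * \<gamma> k" if k: "k \<ge> 1" for k n
    proof -
      have "(\<Sum>t<n. \<gamma> (k + t)) = C * r ^ k * (\<Sum>t<n. r ^ t)"
        using k by (simp add: \<gamma>_r power_add sum_distrib_left mult.assoc)
      also have "(\<Sum>t<n. r ^ t) \<le> 1 / (1 - r)"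
        using r0 r1 by (simp add: sum_gp_strict divide_right_mono)
      finally show ?thesis using C r0 k by (simp add: \<gamma>_r mult_left_mono)
    qed
    show "1 / (1 - r) \<ge> 0" "1 / \<epsilon>\<^sub>0 / (1 - q) > 0" using r1 q assms(1) by auto
  next
    fix p l d w and i k :: nat
    assume bc: "bounded_cholesky p l d w \<epsilon>\<^sub>0"
      and w: "\<And>i k. i < p \<Longrightarrow> k \<ge> 1 \<Longrightarrow> row_tail w i k \<le> \<gamma> k" and ik: "i < p" "k \<ge> 1"
    interpret bounded_cholesky p l d w \<epsilon>\<^sub>0 by (rule bc)
    have "row_tail l i k \<le> C / \<epsilon>\<^sub>0 / (1 - q) * r ^ k"
      unfolding q_def
      using l_tail_geometric[of r C i k] r0 r1 C q w ik \<gamma>_r unfolding q_def by simp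
    thus "row_tail l i k \<le> 1 / \<epsilon>\<^sub>0 / (1 - q) * \<gamma> k" using ik by (simp add: \<gamma>_r)
  qed
next
  assume "\<exists>k\<^sub>0>0. \<forall>k>k\<^sub>0. \<gamma> k = 0"
  then obtain k\<^sub>0 where k0: "\<And>k. k > k\<^sub>0 \<Longrightarrow> \<gamma> k = 0" by blast
  have mono: "\<gamma> n \<le> \<gamma> m" if "1 \<le> m" "m \<le> n" for m n
    using assms(2) that by (auto simp: monotone_on_def)
  have nonneg: "\<gamma> k \<ge> 0" if "k \<ge> 1" for k
    using mono[of k "Suc (k + k\<^sub>0)"] k0[of "Suc (k + k\<^sub>0)"] that by simp
  \<comment> \<open>A multiple of \<open>\<gamma> k\<close> can only bound something nonzero where \<open>\<gamma> k > 0\<close>, so the band width has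
    to be the first zero of \<open>\<gamma>\<close> on the positive integers, which may be smaller than \<open>k\<^sub>0\<close>.\<close>
  define n where "n = (LEAST n. n \<ge> 1 \<and> \<gamma> n = 0)"
  have "Suc k\<^sub>0 \<ge> 1 \<and> \<gamma> (Suc k\<^sub>0) = 0" using k0 by simp
  hence n: "n \<ge> 1" "\<gamma> n = 0" unfolding n_def by (metis (mono_tags, lifting) LeastI)+
  have below: "\<gamma> k \<noteq> 0" if "1 \<le> k" "k < n" for k
    using not_less_Least[of k "\<lambda>n. n \<ge> 1 \<and> \<gamma> n = 0"] that unfolding n_def by blast
  have zero: "\<gamma> k = 0" if "n \<le> k" for k
    using mono[of n k] nonneg[of k] n that by simp
  \<comment> \<open>The least positive value of \<open>\<gamma>\<close> on the positive integers, or \<open>1\<close> if there is none.\<close>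
  define s where "s = (if n = 1 then 1 else \<gamma> (n - 1))"
  have s: "s > 0"
  proof (cases "n = 1")
    case False
    hence "1 \<le> n - 1" "n - 1 < n" using n by auto
    hence "\<gamma> (n - 1) > 0" using below[of "n - 1"] nonneg[of "n - 1"] by linarith
    thus ?thesis using False by (simp add: s_def)
  qed (simp add: s_def)
  have s_le: "s \<le> \<gamma> k" if "1 \<le> k" "k < n" for k
    using mono[of k "n - 1"] that by (auto simp: s_def)
  show ?thesis
  proof (rule U_classes_comparable[OF assms(1), of \<gamma> "real n" "real n / \<epsilon>\<^sub>0 / s"])
    show "0 \<le> \<gamma> k" if "k \<ge> 1" for k using that by (rule nonneg)
    show "(\<Sum>t<N. \<gamma> (k + t)) \<le> real n * \<gamma> k" if k: "k \<ge> 1" for k N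
    proof -
      have "(\<Sum>t<N. \<gamma> (k + t)) \<le> (\<Sum>t<N + n. \<gamma> (k + t))"
        using k nonneg by (intro sum_mono2) auto
      also have "\<dots> = (\<Sum>t<n. \<gamma> (k + t))"
        using zero by (intro sum.mono_neutral_right) auto
      also have "\<dots> \<le> (\<Sum>t<n. \<gamma> k)"
        using k mono by (intro sum_mono) auto
      finally show ?thesis by simp
    qed
    show "real n \<ge> 0" "real n / \<epsilon>\<^sub>0 / s > 0" using n s assms(1) by auto
  next
    fix p l d w and i k :: nat
    assume bc: "bounded_cholesky p l d w \<epsilon>\<^sub>0"
      and w: "\<And>i k. i < p \<Longrightarrow> k \<ge> 1 \<Longrightarrow> row_tail w i k \<le> \<gamma> k" and ik: "i < p" "k \<ge> 1"
    interpret bounded_cholesky p l d w \<epsilon>\<^sub>0 by (rule bc)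
    have w0: "row_tail w i k = 0" if "i < p" "n \<le> k" for i k :: nat
    proof -
      have "row_tail w i k \<le> 0" using w[of i k] zero[of k] that n by simp
      moreover have "row_tail w i k \<ge> 0" by (simp add: row_tail_def sum_nonneg)
      ultimately show ?thesis by simp
    qed
    have l0: "row_tail l i k = 0" if "n \<le> k" for k :: nat
      using w0 ik(1) that by (rule l_tail_banded)
    show "row_tail l i k \<le> real n / \<epsilon>\<^sub>0 / s * \<gamma> k"
    proof (cases "k < n")
      case True
      have "row_tail l i k \<le> real n / \<epsilon>\<^sub>0" using l0[of n] ik(1) by (intro l_tail_le_band_width) auto
      also have "\<dots> = real n / \<epsilon>\<^sub>0 / s * s" using s by simp
      also have "\<dots> \<le> real n / \<epsilon>\<^sub>0 / s * \<gamma> k"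
        using s_le[OF ik(2) True] s assms(1) by (intro mult_left_mono) auto
      finally show ?thesis .
    next
      case False
      thus ?thesis using l0[of k] zero[of k] by simp
    qed
  qed
qed

end
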